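(* Let $(E,C)$ be a separated graph, and $S$ a subset of $C_{\rm fin}$. Then there are mutually inverse lattice isomorphisms $$\varphi:\mathcal A_{C,S}\to\mathcal L(M(E,C,S))\qquad\text{and}\qquad\psi:\mathcal L(M(E,C,S))\to\mathcal A_{C,S},$$ where $\varphi(H,G)=\langle I(H,G)\rangle$ for $(H,G)\in\mathcal A_{C,S}$, and $\psi(I)=(H,G)$ with $$H=\{v\in E^0\mid v\in I\},\qquad G=\{X\in\mathcal G(H)\cap C_{\rm fin}\mid q'_X\in I\}\sqcup\{X\in\mathcal G(H)\cap C_\infty\mid q'_{X/H}\in I\}$$ for $I\in\mathcal L(M(E,C,S))$.
   Context: A graph is a directed graph $E=(E^0,E^1,s,r)$ with $E^0$ a nonempty set (no finiteness or countability assumptions). A separated graph is a pair $(E,C)$ where $C=\bigsqcup_{v\in E^0}C_v$ and each $C_v$ is a partition of $s^{-1}(v)$ into pairwise disjoint nonempty subsets ($C_v=\emptyset$ if $v$ is a sink). $C_{\rm fin}$ is the set of finite members of $C$ and $C_\infty:=C\setminus C_{\rm fin}$. $M(E,C,S)$ is the abelian monoid with generators $E^0\sqcup\{q'_Z\mid Z\subseteq X\in C,\ 0<|Z|<\infty\}$ and relations, where $\mathbf r(Y):=\sum_{e\in Y}r(e)$ for finite $Y\subseteq E^1$: (1) $v=\mathbf r(Z)+q'_Z$ for $v\in E^0$, $Z\subseteq X\in C_v$, $0<|Z|<\infty$; (2) $q'_{Z_1}=\mathbf r(Z_2\setminus Z_1)+q'_{Z_2}$ for finite nonempty subsets $Z_1\subsetneq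 Z_2$ of $X\in C$; (3) $q'_X=0$ for $X\in S$. Elements of $E^0$ and the symbols $q'_Z$ also denote their images in $M(E,C,S)$. An order-ideal of an abelian monoid $M$ is a submonoid $I$ such that $x+y\in I$ implies $x,y\in I$; $\mathcal L(M)$ is the lattice of order-ideals under inclusion; $\langle B\rangle$ is the order-ideal generated by $B\subseteq M$. A subset $H\subseteq E^0$ is hereditary if whenever $v\in H$ and there is a (finite directed) path from $v$ to $w$, then $w\in H$. $H$ is $(C,S)$-saturated if whenever $X\in S\cap C_v$ for some $v\in E^0$ and $r(X)\subseteq H$, then $v\in H$. For $X\subseteq E^1$ let $X/H:=X\cap r^{-1}(E^0\setminus H)$. For hereditary $(C,S)$-saturated $H$, let $\mathcal G(H):=\{X\in C\setminus S\mid X/H\text{ is nonempty and finite}\}$ and $C[H]:=\bigsqcup_{v\in H}C_v$. $\mathcal A_{C,S}$ is the set of all pairs $(H,G)$ with $H$ a hereditary $(C,S)$-saturated subset of $E^0$ and $G\subseteq\mathcal G(H)$, ordered by $$(H_1,G_1)\le(H_2,G_2)\iff H_1\subseteq H_2\ \text{and}\ G_1\subseteq G_2\sqcup C[H_2];$$ it is a complete lattice. For $(H,G)\in\mathcal A_{C,S}$, $I(H,G)$ is the submonoid of $M(E,C,S)$ generated by $H\sqcup\{q'_X\mid X\in C_{\rm fin}\cap G\}\sqcup\{q'_{X/H}\mid X\in C_\infty\cap G\}$. *)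

theory Defs
  imports
    "Graph_Theory.Digraph"
    "HOL-Library.Multiset"
    "HOL-Library.Disjoint_Sets"
    "HOL-Algebra.Group"
begin

section \<open>Abelian monoids given by generators and relations\<close>

text \<open>The free abelian monoid on a set \<open>A\<close> consists of the finite multisets over \<open>A\<close>,
  and a presentation is factored out by the least congruence containing its relations.\<close>

definition free_words :: "'g set \<Rightarrow> 'g multiset set" where
  "free_words A = {w. set_mset w \<subseteq> A}"

inductive pres_cong :: "'g set \<Rightarrow> ('g multiset \<times> 'g multiset) set \<Rightarrow> 'g multiset \<Rightarrow> 'g multiset \<Rightarrow> bool"
  for A R where
  rel: "\<lbrakk>(a, b) \<in> R; a \<in> free_words A; b \<in> free_words A\<rbrakk> \<Longrightarrow> pres_cong A R a b"
| refl: "a \<in> free_words A \<Longrightarrow> pres_cong A R a a"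
| sym: "pres_cong A R a b \<Longrightarrow> pres_cong A R b a"
| trans: "\<lbrakk>pres_cong A R a b; pres_cong A R b c\<rbrakk> \<Longrightarrow> pres_cong A R a c"
| add: "\<lbrakk>pres_cong A R a b; c \<in> free_words A\<rbrakk> \<Longrightarrow> pres_cong A R (a + c) (b + c)"

definition pres_rel :: "'g set \<Rightarrow> ('g multiset \<times> 'g multiset) set \<Rightarrow> ('g multiset \<times> 'g multiset) set" where
  "pres_rel A R = {(a, b). pres_cong A R a b}"

definition pres_class :: "'g set \<Rightarrow> ('g multiset \<times> 'g multiset) set \<Rightarrow> 'g multiset \<Rightarrow> 'g multiset set" where
  "pres_class A R w = pres_rel A R `` {w}"

definition pres_monoid :: "'g set \<Rightarrow> ('g multiset \<times> 'g multiset) set \<Rightarrow> 'g multiset set monoid" where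
  "pres_monoid A R =
    \<lparr>carrier = free_words A // pres_rel A R,
     monoid.mult = (\<lambda>x y. \<Union>a\<in>x. \<Union>b\<in>y. pres_class A R (a + b)),
     one = pres_class A R {#}\<rparr>"

lemma pres_cong_free_words:
  "pres_cong A R a b \<Longrightarrow> a \<in> free_words A \<and> b \<in> free_words A"
  by (induction rule: pres_cong.induct) (auto simp: free_words_def)

lemma equiv_pres_rel: "equiv (free_words A) (pres_rel A R)"
proof (rule equivI)
  show "refl_on (free_words A) (pres_rel A R)"
    by (auto simp: refl_on_def pres_rel_def intro: pres_cong.refl)
  show "pres_rel A R \<subseteq> free_words A \<times> free_words A"
    by (auto simp: pres_rel_def dest: pres_cong_free_words)
qed (auto simp: sym_def trans_def pres_rel_def intro: pres_cong.sym pres_cong.trans)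

lemma pres_cong_add:
  assumes "pres_cong A R a a'" "pres_cong A R b b'"
  shows "pres_cong A R (a + b) (a' + b')"
proof -
  have "pres_cong A R (a + b) (a' + b)"
    using assms pres_cong_free_words pres_cong.add by metis
  moreover have "pres_cong A R (b + a') (b' + a')"
    using assms pres_cong_free_words pres_cong.add by metis
  ultimately show ?thesis
    by (metis add.commute pres_cong.trans)
qed

lemma pres_class_in_carrier:
  "w \<in> free_words A \<Longrightarrow> pres_class A R w \<in> carrier (pres_monoid A R)"
  by (simp add: pres_class_def pres_monoid_def quotientI)

lemma carrier_pres_monoidE:
  assumes "x \<in> carrier (pres_monoid A R)"
  obtains w where "w \<in> free_words A" "x = pres_class A R w"
  using assms by (auto simp: pres_class_def pres_monoid_def elim: quotientE)

lemma pres_class_eq_iff: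
  assumes "a \<in> free_words A" "b \<in> free_words A"
  shows "pres_class A R a = pres_class A R b \<longleftrightarrow> pres_cong A R a b"
  using eq_equiv_class_iff[OF equiv_pres_rel assms] by (simp add: pres_class_def pres_rel_def)

lemma pres_class_mult:
  assumes "a \<in> free_words A" "b \<in> free_words A"
  shows "pres_class A R a \<otimes>\<^bsub>pres_monoid A R\<^esub> pres_class A R b = pres_class A R (a + b)"
proof -
  have "pres_class A R (a' + b') = pres_class A R (a + b)"
    if "a' \<in> pres_class A R a" "b' \<in> pres_class A R b" for a' b'
  proof -
    have "pres_cong A R (a + b) (a' + b')"
      using that by (intro pres_cong_add) (auto simp: pres_class_def pres_rel_def)
    then show ?thesis
      using pres_class_eq_iff pres_cong_free_words by metis
  qed
  then have "(\<Union>a'\<in>pres_class A R a. \<Union>b'\<in>pres_class A R b. pres_class A R (a' + b')) =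
      (\<Union>a'\<in>pres_class A R a. \<Union>b'\<in>pres_class A R b. pres_class A R (a + b))"
    by (intro SUP_cong) auto
  moreover have "pres_class A R a \<noteq> {}" "pres_class A R b \<noteq> {}"
    using assms by (auto simp: pres_class_def pres_rel_def intro: pres_cong.refl)
  ultimately show ?thesis
    by (simp add: pres_monoid_def)
qed

lemma comm_monoid_pres_monoid: "comm_monoid (pres_monoid A R)"
proof -
  have one: "\<one>\<^bsub>pres_monoid A R\<^esub> = pres_class A R {#}"
    by (simp add: pres_monoid_def)
  have z: "{#} \<in> free_words A" by (simp add: free_words_def)
  have p: "a + b \<in> free_words A" if "a \<in> free_words A" "b \<in> free_words A" for a b
    using that by (simp add: free_words_def)
  show ?thesis
  proof (rule comm_monoidI)
    fix x y assume "x \<in> carrier (pres_monoid A R)" "y \<in> carrier (pres_monoid A R)"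
    then obtain a b where w: "a \<in> free_words A" "b \<in> free_words A"
      and xy: "x = pres_class A R a" "y = pres_class A R b"
      by (metis carrier_pres_monoidE)
    show "x \<otimes>\<^bsub>pres_monoid A R\<^esub> y \<in> carrier (pres_monoid A R)"
      unfolding xy by (simp add: pres_class_mult pres_class_in_carrier w p)
    show "x \<otimes>\<^bsub>pres_monoid A R\<^esub> y = y \<otimes>\<^bsub>pres_monoid A R\<^esub> x"
      unfolding xy by (simp add: pres_class_mult w add.commute)
    fix z assume "z \<in> carrier (pres_monoid A R)"
    then obtain c where c: "c \<in> free_words A" "z = pres_class A R c"
      by (rule carrier_pres_monoidE)
    show "x \<otimes>\<^bsub>pres_monoid A R\<^esub> y \<otimes>\<^bsub>pres_monoid A R\<^esub> z =
        x \<otimes>\<^bsub>pres_monoid A R\<^esub> (y \<otimes>\<^bsub>pres_monoid A R\<^esub> z)"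
      unfolding xy c(2) by (simp add: pres_class_mult w c(1) p add.assoc)
  next
    show "\<one>\<^bsub>pres_monoid A R\<^esub> \<in> carrier (pres_monoid A R)"
      by (simp add: one pres_class_in_carrier z)
  next
    fix x assume "x \<in> carrier (pres_monoid A R)"
    then obtain a where "a \<in> free_words A" "x = pres_class A R a"
      by (rule carrier_pres_monoidE)
    then show "\<one>\<^bsub>pres_monoid A R\<^esub> \<otimes>\<^bsub>pres_monoid A R\<^esub> x = x"
      by (simp add: one pres_class_mult z)
  qed
qed


section \<open>Order-ideals\<close>

definition order_ideal :: "'a set \<Rightarrow> ('a, 'm) monoid_scheme \<Rightarrow> bool" where
  "order_ideal I M \<longleftrightarrow> submonoid I M \<and>
    (\<forall>x\<in>carrier M. \<forall>y\<in>carrier M. x \<otimes>\<^bsub>M\<^esub> y \<in> I \<longrightarrow> x \<in> I \<and> y \<in> I)"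

definition gen_submonoid :: "('a, 'm) monoid_scheme \<Rightarrow> 'a set \<Rightarrow> 'a set" where
  "gen_submonoid M B = \<Inter> {N. submonoid N M \<and> B \<subseteq> N}"

definition gen_order_ideal :: "('a, 'm) monoid_scheme \<Rightarrow> 'a set \<Rightarrow> 'a set" where
  "gen_order_ideal M B = \<Inter> {I. order_ideal I M \<and> B \<subseteq> I}"

definition order_ideal_lattice :: "('a, 'm) monoid_scheme \<Rightarrow> 'a set gorder" where
  "order_ideal_lattice M = \<lparr>carrier = {I. order_ideal I M}, eq = (=), le = (\<subseteq>)\<rparr>"

text \<open>\<^const>\<open>join_pres\<close> and \<^const>\<open>meet_pres\<close> include that both structures are lattices.\<close>

definition lattice_iso ::
    "('a, 'c) gorder_scheme \<Rightarrow> ('b, 'd) gorder_scheme \<Rightarrow> ('a \<Rightarrow> 'b) \<Rightarrow> bool" where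
  "lattice_iso X Y f \<longleftrightarrow> bij_betw f (carrier X) (carrier Y) \<and> join_pres X Y f \<and> meet_pres X Y f"


section \<open>Separated graphs\<close>

text \<open>The source and range maps \<open>s\<close> and \<open>r\<close> of the graph are \<^const>\<open>tail\<close> and \<^const>\<open>head\<close>.
  The family \<open>C\<close> assigns to each vertex \<open>v\<close> the partition \<open>C\<^sub>v\<close>; its values outside
  the vertex set are irrelevant.\<close>

locale separated_graph = wf_digraph E for E :: "('v, 'e) pre_digraph" (structure) +
  fixes C :: "'v \<Rightarrow> 'e set set"
  assumes verts_nonempty: "verts E \<noteq> {}"
    and partition: "v \<in> verts E \<Longrightarrow> partition_on (out_arcs E v) (C v)"

definition sep_sets :: "('v, 'e) pre_digraph \<Rightarrow> ('v \<Rightarrow> 'e set set) \<Rightarrow> 'e set set" where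
  "sep_sets E C = (\<Union>v\<in>verts E. C v)"

definition sep_fin :: "('v, 'e) pre_digraph \<Rightarrow> ('v \<Rightarrow> 'e set set) \<Rightarrow> 'e set set" where
  "sep_fin E C = {X \<in> sep_sets E C. finite X}"

definition sep_inf :: "('v, 'e) pre_digraph \<Rightarrow> ('v \<Rightarrow> 'e set set) \<Rightarrow> 'e set set" where
  "sep_inf E C = sep_sets E C - sep_fin E C"

text \<open>\<open>Rest Z\<close> is the symbol \<open>q'\<^sub>Z\<close>.\<close>

datatype ('v, 'e) generator = Vertex 'v | Rest "'e set"

definition sg_generators ::
    "('v, 'e) pre_digraph \<Rightarrow> ('v \<Rightarrow> 'e set set) \<Rightarrow> ('v, 'e) generator set" where
  "sg_generators E C = Vertex ` verts E \<union>
    {Rest Z | Z X. X \<in> sep_sets E C \<and> Z \<subseteq> X \<and> Z \<noteq> {} \<and> finite Z}"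

definition range_sum :: "('v, 'e) pre_digraph \<Rightarrow> 'e set \<Rightarrow> ('v, 'e) generator multiset" where
  "range_sum E Y = image_mset (\<lambda>e. Vertex (head E e)) (mset_set Y)"

definition sg_relations ::
    "('v, 'e) pre_digraph \<Rightarrow> ('v \<Rightarrow> 'e set set) \<Rightarrow> 'e set set \<Rightarrow>
      (('v, 'e) generator multiset \<times> ('v, 'e) generator multiset) set" where
  "sg_relations E C S =
    {({#Vertex v#}, range_sum E Z + {#Rest Z#}) | v X Z.
        v \<in> verts E \<and> X \<in> C v \<and> Z \<subseteq> X \<and> Z \<noteq> {} \<and> finite Z} \<union>
    {({#Rest Z\<^sub>1#}, range_sum E (Z\<^sub>2 - Z\<^sub>1) + {#Rest Z\<^sub>2#}) | X Z\<^sub>1 Z\<^sub>2.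
        X \<in> sep_sets E C \<and> Z\<^sub>2 \<subseteq> X \<and> finite Z\<^sub>2 \<and> Z\<^sub>1 \<noteq> {} \<and> Z\<^sub>1 \<subset> Z\<^sub>2} \<union>
    {({#Rest X#}, {#}) | X. X \<in> S}"

definition sg_monoid ::
    "('v, 'e) pre_digraph \<Rightarrow> ('v \<Rightarrow> 'e set set) \<Rightarrow> 'e set set \<Rightarrow>
      ('v, 'e) generator multiset set monoid" where
  "sg_monoid E C S = pres_monoid (sg_generators E C) (sg_relations E C S)"

definition vertex_elt ::
    "('v, 'e) pre_digraph \<Rightarrow> ('v \<Rightarrow> 'e set set) \<Rightarrow> 'e set set \<Rightarrow> 'v \<Rightarrow>
      ('v, 'e) generator multiset set" where
  "vertex_elt E C S v = pres_class (sg_generators E C) (sg_relations E C S) {#Vertex v#}"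

definition rest_elt ::
    "('v, 'e) pre_digraph \<Rightarrow> ('v \<Rightarrow> 'e set set) \<Rightarrow> 'e set set \<Rightarrow> 'e set \<Rightarrow>
      ('v, 'e) generator multiset set" where
  "rest_elt E C S Z = pres_class (sg_generators E C) (sg_relations E C S) {#Rest Z#}"


section \<open>The lattice of admissible pairs\<close>

definition hereditary :: "('v, 'e) pre_digraph \<Rightarrow> 'v set \<Rightarrow> bool" where
  "hereditary E H \<longleftrightarrow> H \<subseteq> verts E \<and> (\<forall>v\<in>H. \<forall>w. v \<rightarrow>\<^sup>*\<^bsub>E\<^esub> w \<longrightarrow> w \<in> H)"

definition saturated ::
    "('v, 'e) pre_digraph \<Rightarrow> ('v \<Rightarrow> 'e set set) \<Rightarrow> 'e set set \<Rightarrow> 'v set \<Rightarrow> bool" where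
  "saturated E C S H \<longleftrightarrow>
    (\<forall>v\<in>verts E. \<forall>X. X \<in> S \<inter> C v \<and> head E ` X \<subseteq> H \<longrightarrow> v \<in> H)"

text \<open>\<open>quot_set E X H\<close> is \<open>X/H\<close>.\<close>

definition quot_set :: "('v, 'e) pre_digraph \<Rightarrow> 'e set \<Rightarrow> 'v set \<Rightarrow> 'e set" where
  "quot_set E X H = {e \<in> X. head E e \<in> verts E - H}"

text \<open>\<open>sep_over C H\<close> is \<open>C[H]\<close>.\<close>

definition sep_over :: "('v \<Rightarrow> 'e set set) \<Rightarrow> 'v set \<Rightarrow> 'e set set" where
  "sep_over C H = (\<Union>v\<in>H. C v)"

text \<open>\<open>breaking_sets E C S H\<close> is \<open>\<G>(H)\<close>.\<close>

definition breaking_sets ::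
    "('v, 'e) pre_digraph \<Rightarrow> ('v \<Rightarrow> 'e set set) \<Rightarrow> 'e set set \<Rightarrow> 'v set \<Rightarrow> 'e set set" where
  "breaking_sets E C S H =
    {X \<in> sep_sets E C - S. quot_set E X H \<noteq> {} \<and> finite (quot_set E X H)}"

definition admissible_pairs ::
    "('v, 'e) pre_digraph \<Rightarrow> ('v \<Rightarrow> 'e set set) \<Rightarrow> 'e set set \<Rightarrow> ('v set \<times> 'e set set) gorder" where
  "admissible_pairs E C S =
    \<lparr>carrier = {(H, G). hereditary E H \<and> saturated E C S H \<and> G \<subseteq> breaking_sets E C S H},
     eq = (=),
     le = (\<lambda>(H\<^sub>1, G\<^sub>1) (H\<^sub>2, G\<^sub>2). H\<^sub>1 \<subseteq> H\<^sub>2 \<and> G\<^sub>1 \<subseteq> G\<^sub>2 \<union> sep_over C H\<^sub>2)\<rparr>"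

text \<open>\<open>pair_submonoid E C S H G\<close> is \<open>I(H, G)\<close>.\<close>

definition pair_submonoid ::
    "('v, 'e) pre_digraph \<Rightarrow> ('v \<Rightarrow> 'e set set) \<Rightarrow> 'e set set \<Rightarrow> 'v set \<Rightarrow> 'e set set \<Rightarrow>
      ('v, 'e) generator multiset set set" where
  "pair_submonoid E C S H G = gen_submonoid (sg_monoid E C S)
    (vertex_elt E C S ` H \<union>
     {rest_elt E C S X | X. X \<in> sep_fin E C \<inter> G} \<union>
     {rest_elt E C S (quot_set E X H) | X. X \<in> sep_inf E C \<inter> G})"

end

theory Submission
  imports Defs
begin

text \<open>
  An order-ideal of a commutative monoid contains a sum exactly when it contains both summands.
  For a monoid given by generators and relations, an order-ideal is therefore determined by the
  set of generators that it contains, and a set \<open>T\<close> of generators arises in this way if and only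
  if for every defining relation \<open>a = b\<close> the word \<open>a\<close> is written in letters from \<open>T\<close>
  exactly when \<open>b\<close> is. Indeed this condition is inherited by the congruence that the relations
  generate, so that ``all letters lie in \<open>T\<close>'' is a property of the elements of the monoid.
  These facts are \<open>order_ideal_words_ideal\<close>,
  \<open>compatible_ideal_letters\<close>, \<open>words_ideal_ideal_letters\<close> and \<open>ideal_letters_words_ideal\<close>.

  It remains to match compatible sets of generators of \<open>M(E, C, S)\<close> with pairs \<open>(H, G)\<close>.
  Let \<open>T\<close> be compatible, \<open>H\<close> the set of vertices in \<open>T\<close>, and \<open>Z \<subseteq> X \<in> C\<^sub>v\<close> finite and
  nonempty. If \<open>v \<in> H\<close>, the relation \<open>v = r(Z) + q'\<^sub>Z\<close> puts \<open>q'\<^sub>Z\<close> into \<open>T\<close>. If \<open>v \<notin> H\<close> and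
  \<open>q'\<^sub>Z \<in> T\<close>, then enlarging \<open>Z\<close> by an edge \<open>e \<in> X - Z\<close> shows \<open>r(e) \<in> H\<close>, so \<open>X/H \<subseteq> Z\<close>; and
  \<open>X/H\<close> is nonempty, since otherwise \<open>r(Z)\<close> and \<open>q'\<^sub>Z\<close>, hence \<open>v\<close>, would lie in \<open>T\<close>. All
  \<open>q'\<^sub>Z\<close> with \<open>X/H \<subseteq> Z \<subseteq> X\<close> differ from \<open>q'\<^bsub>X/H\<^esub>\<close> only by vertices of \<open>H\<close>, so they lie in
  \<open>T\<close> together or not at all, and for \<open>X \<in> S\<close> they do because \<open>q'\<^sub>X = 0\<close>. Thus the only
  freedom left after \<open>H\<close> is the set \<open>G\<close> of those \<open>X \<notin> S\<close> with \<open>X/H\<close> finite and nonempty for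
  which \<open>q'\<^bsub>X/H\<^esub> \<in> T\<close>, and this description of \<open>T\<close> by \<open>(H, G)\<close> is the definition of
  \<open>pair_letters\<close>. The lemmas \<open>compatible_pair_letters\<close>, \<open>admissible_letters\<close>,
  \<open>pair_letters_letter_pair\<close>, \<open>letter_verts_pair_letters\<close> and \<open>letter_sets_pair_letters\<close> make
  this a bijection, and \<open>pair_letters_mono_iff\<close> identifies inclusion of letter sets with the
  order on pairs.

  Both maps of the theorem are thus order isomorphisms. The order-ideals form a lattice because
  they are closed under intersection, and the lattice structure is transported to the pairs.
\<close>

section \<open>Order isomorphisms of lattices\<close>

lemma least_Upper_order_iso:
  assumes f: "bij_betw f (carrier X) (carrier Y)"
    and le: "\<And>x y. \<lbrakk>x \<in> carrier X; y \<in> carrier X\<rbrakk> \<Longrightarrow> le Y (f x) (f y) \<longleftrightarrow> le X x y"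
    and B: "B \<subseteq> carrier X" and s: "least X s (Upper X B)"
  shows "least Y (f s) (Upper Y (f ` B))"
proof (rule least_UpperI)
  have sX: "s \<in> carrier X" using s by simp
  then show "f s \<in> carrier Y" and "f ` B \<subseteq> carrier Y"
    using f B by (auto simp: bij_betw_def)
  show "le Y y (f s)" if "y \<in> f ` B" for y
    using that B sX le least_Upper_above[OF s _ B] by fastforce
  show "le Y (f s) y" if "y \<in> Upper Y (f ` B)" for y
  proof -
    have "y \<in> carrier Y" using that by (simp add: Upper_def)
    then obtain x where x: "x \<in> carrier X" "y = f x" using f by (auto simp: bij_betw_def)
    have "le X b x" if "b \<in> B" for b
    proof -
      have "b \<in> carrier X" "f b \<in> carrier Y"
        using that B f by (auto simp: bij_betw_def)
      then have "le Y (f b) (f x)"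
        using \<open>y \<in> Upper Y (f ` B)\<close> that x by (simp add: Upper_def)
      then show ?thesis using le \<open>b \<in> carrier X\<close> x by blast
    qed
    then have "x \<in> Upper X B" using x by (simp add: Upper_def)
    then show ?thesis using least_le[OF s] x le sX by simp
  qed
qed

lemma greatest_Lower_order_iso:
  assumes "bij_betw f (carrier X) (carrier Y)"
    and "\<And>x y. \<lbrakk>x \<in> carrier X; y \<in> carrier X\<rbrakk> \<Longrightarrow> le Y (f x) (f y) \<longleftrightarrow> le X x y"
    and "B \<subseteq> carrier X" and "greatest X s (Lower X B)"
  shows "greatest Y (f s) (Lower Y (f ` B))"
  using least_Upper_order_iso[of f "inv_gorder X" "inv_gorder Y" B s] assms by simp

text \<open>Joins and meets are determined by the order alone, so an order isomorphism carries them over,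
  and with them the existence of joins and meets.\<close>

lemma order_iso_lattice_iso:
  assumes X: "lattice X" and Y: "partial_order Y"
    and f: "bij_betw f (carrier X) (carrier Y)"
    and le: "\<And>x y. \<lbrakk>x \<in> carrier X; y \<in> carrier X\<rbrakk> \<Longrightarrow> le Y (f x) (f y) \<longleftrightarrow> le X x y"
  shows "lattice Y" and "lattice_iso X Y f"
proof -
  interpret X: lattice X by fact
  interpret Y: partial_order Y by fact
  have sup: "least Y (f (x \<squnion>\<^bsub>X\<^esub> y)) (Upper Y {f x, f y})"
    if "x \<in> carrier X" "y \<in> carrier X" for x y
    using least_Upper_order_iso[OF f le, of "{x, y}"] X.sup_of_two_least[OF that] that
    by (simp add: join_def)
  have inf: "greatest Y (f (x \<sqinter>\<^bsub>X\<^esub> y)) (Lower Y {f x, f y})"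
    if "x \<in> carrier X" "y \<in> carrier X" for x y
    using greatest_Lower_order_iso[OF f le, of "{x, y}"] X.inf_of_two_greatest[OF that] that
    by (simp add: meet_def)
  have onto: "\<exists>x'\<in>carrier X. x = f x'" if "x \<in> carrier Y" for x
    using that f by (auto simp: bij_betw_def)
  show lat: "lattice Y"
  proof unfold_locales
    fix x y assume "x \<in> carrier Y" "y \<in> carrier Y"
    then obtain x' y' where "x' \<in> carrier X" "x = f x'" "y' \<in> carrier X" "y = f y'"
      using onto by metis
    then show "\<exists>s. least Y s (Upper Y {x, y})" "\<exists>s. greatest Y s (Lower Y {x, y})"
      using sup inf by blast+
  qed
  then interpret Y: lattice Y .
  have fc: "f x \<in> carrier Y" if "x \<in> carrier X" for x
    using that f by (auto simp: bij_betw_def)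
  have "f (x \<squnion>\<^bsub>X\<^esub> y) = f x \<squnion>\<^bsub>Y\<^esub> f y" if "x \<in> carrier X" "y \<in> carrier X" for x y
    using Y.least_unique[OF sup[OF that]] Y.sup_of_two_least[OF fc[OF that(1)] fc[OF that(2)]]
    by (simp add: join_def)
  moreover have "f (x \<sqinter>\<^bsub>X\<^esub> y) = f x \<sqinter>\<^bsub>Y\<^esub> f y" if "x \<in> carrier X" "y \<in> carrier X" for x y
    using Y.greatest_unique[OF inf[OF that]] Y.inf_of_two_greatest[OF fc[OF that(1)] fc[OF that(2)]]
    by (simp add: meet_def)
  ultimately show "lattice_iso X Y f"
    using f X lat by (simp add: lattice_iso_def join_pres_def meet_pres_def)
qed


section \<open>The lattice of order-ideals of a monoid\<close>

lemma order_ideal_carrier: "monoid M \<Longrightarrow> order_ideal (carrier M) M"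
  by (auto simp: order_ideal_def submonoid_def monoid.m_closed monoid.one_closed)

lemma order_ideal_Inter:
  assumes "\<I> \<noteq> {}" "\<And>I. I \<in> \<I> \<Longrightarrow> order_ideal I M"
  shows "order_ideal (\<Inter>\<I>) M"
  using assms unfolding order_ideal_def submonoid_def by blast

lemma order_ideal_lattice_lattice:
  assumes "monoid M"
  shows "lattice (order_ideal_lattice M)"
proof -
  let ?L = "order_ideal_lattice M"
  interpret partial_order ?L
    by unfold_locales (auto simp: order_ideal_lattice_def)
  show ?thesis
  proof unfold_locales
    fix I J assume IJ: "I \<in> carrier ?L" "J \<in> carrier ?L"
    let ?U = "{K. order_ideal K M \<and> I \<union> J \<subseteq> K}"
    have "I \<subseteq> carrier M" "J \<subseteq> carrier M"
      using IJ by (auto simp: order_ideal_lattice_def order_ideal_def submonoid_def)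
    then have "carrier M \<in> ?U"
      using order_ideal_carrier[OF assms] by auto
    then have "order_ideal (\<Inter>?U) M"
      by (intro order_ideal_Inter) auto
    then have "least ?L (\<Inter>?U) (Upper ?L {I, J})"
      using IJ by (intro least_UpperI) (auto simp: order_ideal_lattice_def Upper_def)
    then show "\<exists>K. least ?L K (Upper ?L {I, J})" by blast
    have "order_ideal (I \<inter> J) M"
      using order_ideal_Inter[of "{I, J}" M] IJ by (auto simp: order_ideal_lattice_def)
    then have "greatest ?L (I \<inter> J) (Lower ?L {I, J})"
      using IJ by (intro greatest_LowerI) (auto simp: order_ideal_lattice_def Lower_def)
    then show "\<exists>K. greatest ?L K (Lower ?L {I, J})" by blast
  qed
qed

lemma gen_submonoid_subset_iff:
  assumes "submonoid N M"
  shows "gen_submonoid M B \<subseteq> N \<longleftrightarrow> B \<subseteq> N"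
  using assms by (auto simp: gen_submonoid_def)


section \<open>Order-ideals of a presented monoid\<close>

text \<open>Relations between words that use letters outside \<open>A\<close> generate nothing in the congruence and so
  impose no condition on \<open>T\<close>.\<close>

definition compatible_letters ::
    "'g set \<Rightarrow> ('g multiset \<times> 'g multiset) set \<Rightarrow> 'g set \<Rightarrow> bool" where
  "compatible_letters A R T \<longleftrightarrow> T \<subseteq> A \<and>
    (\<forall>(a, b) \<in> R. a \<in> free_words A \<longrightarrow> b \<in> free_words A \<longrightarrow>
      (a \<in> free_words T \<longleftrightarrow> b \<in> free_words T))"

definition words_ideal ::
    "'g set \<Rightarrow> ('g multiset \<times> 'g multiset) set \<Rightarrow> 'g set \<Rightarrow> 'g multiset set set" where
  "words_ideal A R T = pres_class A R ` free_words T"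

definition ideal_letters ::
    "'g set \<Rightarrow> ('g multiset \<times> 'g multiset) set \<Rightarrow> 'g multiset set set \<Rightarrow> 'g set" where
  "ideal_letters A R I = {g \<in> A. pres_class A R {#g#} \<in> I}"

lemma free_words_add_iff [simp]:
  "a + b \<in> free_words A \<longleftrightarrow> a \<in> free_words A \<and> b \<in> free_words A"
  by (auto simp: free_words_def)

lemma free_words_empty [simp]: "{#} \<in> free_words A"
  by (simp add: free_words_def)

lemma free_words_add_mset [simp]:
  "add_mset g w \<in> free_words A \<longleftrightarrow> g \<in> A \<and> w \<in> free_words A"
  by (simp add: free_words_def)

lemma free_words_mono: "A \<subseteq> B \<Longrightarrow> free_words A \<subseteq> free_words B"
  by (auto simp: free_words_def)

text \<open>For a generating pair of the congruence this is the definition of compatibility, and it survives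
  adding a common word \<open>c\<close> because \<open>a + c\<close> has its letters in \<open>T\<close> exactly when \<open>a\<close> and \<open>c\<close> do.
  Hence membership of an element in the ideal can be read off from any word that represents it.\<close>

lemma compatible_letters_pres_cong:
  assumes "pres_cong A R a b" "compatible_letters A R T"
  shows "a \<in> free_words T \<longleftrightarrow> b \<in> free_words T"
  using assms by (induction rule: pres_cong.induct) (auto simp: compatible_letters_def)

lemma pres_class_in_words_ideal_iff:
  assumes T: "compatible_letters A R T" and w: "w \<in> free_words A"
  shows "pres_class A R w \<in> words_ideal A R T \<longleftrightarrow> w \<in> free_words T"
proof
  assume "pres_class A R w \<in> words_ideal A R T"
  then obtain u where u: "u \<in> free_words T" "pres_class A R w = pres_class A R u"
    by (auto simp: words_ideal_def)
  moreover have "u \<in> free_words A"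
    using u T free_words_mono by (fastforce simp: compatible_letters_def)
  ultimately show "w \<in> free_words T"
    using w T pres_class_eq_iff compatible_letters_pres_cong by metis
qed (simp add: words_ideal_def)

lemma order_ideal_words_ideal:
  assumes T: "compatible_letters A R T"
  shows "order_ideal (words_ideal A R T) (pres_monoid A R)"
proof -
  have sub: "free_words T \<subseteq> free_words A"
    using T free_words_mono by (auto simp: compatible_letters_def)
  have "submonoid (words_ideal A R T) (pres_monoid A R)"
  proof
    show "words_ideal A R T \<subseteq> carrier (pres_monoid A R)"
      using sub by (auto simp: words_ideal_def intro!: pres_class_in_carrier)
    show "\<one>\<^bsub>pres_monoid A R\<^esub> \<in> words_ideal A R T"
      by (simp add: pres_monoid_def words_ideal_def)
    fix x y assume "x \<in> words_ideal A R T" "y \<in> words_ideal A R T"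
    then obtain a b where "a \<in> free_words T" "b \<in> free_words T"
      "x = pres_class A R a" "y = pres_class A R b"
      by (auto simp: words_ideal_def)
    moreover from this have "a \<in> free_words A" "b \<in> free_words A" using sub by auto
    ultimately show "x \<otimes>\<^bsub>pres_monoid A R\<^esub> y \<in> words_ideal A R T"
      by (simp add: pres_class_mult words_ideal_def)
  qed
  moreover have "x \<in> words_ideal A R T \<and> y \<in> words_ideal A R T"
    if xy: "x \<in> carrier (pres_monoid A R)" "y \<in> carrier (pres_monoid A R)"
      and m: "x \<otimes>\<^bsub>pres_monoid A R\<^esub> y \<in> words_ideal A R T" for x y
  proof -
    obtain a b where ab: "a \<in> free_words A" "b \<in> free_words A"
      "x = pres_class A R a" "y = pres_class A R b"
      using xy by (metis carrier_pres_monoidE)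
    then show ?thesis
      using m pres_class_in_words_ideal_iff[OF T] by (simp add: pres_class_mult)
  qed
  ultimately show ?thesis by (auto simp: order_ideal_def)
qed

text \<open>An element is a sum of generators, and an order-ideal contains a sum exactly when it contains
  every summand.\<close>

lemma pres_class_in_order_ideal_iff:
  assumes I: "order_ideal I (pres_monoid A R)" and w: "w \<in> free_words A"
  shows "pres_class A R w \<in> I \<longleftrightarrow> w \<in> free_words (ideal_letters A R I)"
  using w
proof (induction w)
  case empty
  have "\<one>\<^bsub>pres_monoid A R\<^esub> \<in> I" using I by (simp add: order_ideal_def submonoid_def)
  then show ?case by (simp add: pres_monoid_def)
next
  case (add g w)
  then have gw: "{#g#} \<in> free_words A" "w \<in> free_words A"
    by (auto simp: free_words_def)
  have "pres_class A R (add_mset g w) = pres_class A R {#g#} \<otimes>\<^bsub>pres_monoid A R\<^esub> pres_class A R w"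
    using gw by (simp add: pres_class_mult)
  also have "\<dots> \<in> I \<longleftrightarrow> pres_class A R {#g#} \<in> I \<and> pres_class A R w \<in> I"
    using I pres_class_in_carrier[OF gw(1), of R] pres_class_in_carrier[OF gw(2), of R]
    unfolding order_ideal_def submonoid_def by blast
  also have "\<dots> \<longleftrightarrow> add_mset g w \<in> free_words (ideal_letters A R I)"
    using add gw by (auto simp: free_words_def ideal_letters_def)
  finally show ?case .
qed

text \<open>The two sides of a relation represent the same element.\<close>

lemma compatible_ideal_letters:
  assumes "order_ideal I (pres_monoid A R)"
  shows "compatible_letters A R (ideal_letters A R I)"
proof -
  have "a \<in> free_words (ideal_letters A R I) \<longleftrightarrow> b \<in> free_words (ideal_letters A R I)"
    if "(a, b) \<in> R" "a \<in> free_words A" "b \<in> free_words A" for a b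
    using pres_class_in_order_ideal_iff[OF assms] pres_class_eq_iff[of a A b R]
      pres_cong.rel[OF that] that by metis
  then show ?thesis
    by (auto simp: compatible_letters_def ideal_letters_def)
qed

lemma words_ideal_ideal_letters:
  assumes I: "order_ideal I (pres_monoid A R)"
  shows "words_ideal A R (ideal_letters A R I) = I"
proof
  have sub: "free_words (ideal_letters A R I) \<subseteq> free_words A"
    by (rule free_words_mono) (auto simp: ideal_letters_def)
  then show "words_ideal A R (ideal_letters A R I) \<subseteq> I"
    using pres_class_in_order_ideal_iff[OF I] by (auto simp: words_ideal_def)
  show "I \<subseteq> words_ideal A R (ideal_letters A R I)"
  proof
    fix x assume x: "x \<in> I"
    then have "x \<in> carrier (pres_monoid A R)"
      using I by (auto simp: order_ideal_def submonoid_def)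
    then obtain w where "w \<in> free_words A" "x = pres_class A R w"
      by (rule carrier_pres_monoidE)
    then show "x \<in> words_ideal A R (ideal_letters A R I)"
      using x pres_class_in_order_ideal_iff[OF I] by (simp add: words_ideal_def)
  qed
qed

lemma ideal_letters_words_ideal:
  assumes "compatible_letters A R T"
  shows "ideal_letters A R (words_ideal A R T) = T"
  using pres_class_in_words_ideal_iff[OF assms] assms
  by (auto simp: ideal_letters_def compatible_letters_def)

lemma words_ideal_subset_iff:
  assumes "compatible_letters A R T" "order_ideal I (pres_monoid A R)"
  shows "words_ideal A R T \<subseteq> I \<longleftrightarrow> T \<subseteq> ideal_letters A R I"
proof
  assume "words_ideal A R T \<subseteq> I"
  then show "T \<subseteq> ideal_letters A R I"
    using assms(1) by (force simp: words_ideal_def ideal_letters_def compatible_letters_def)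
next
  assume "T \<subseteq> ideal_letters A R I"
  then have "words_ideal A R T \<subseteq> words_ideal A R (ideal_letters A R I)"
    unfolding words_ideal_def by (intro image_mono free_words_mono)
  then show "words_ideal A R T \<subseteq> I"
    by (simp add: words_ideal_ideal_letters[OF assms(2)])
qed


section \<open>Compatible letters of a separated graph\<close>

text \<open>The defining relations form families with three parameters; this puts a bounded quantifier over
  such a family into a form that the simplifier can rewrite with.\<close>

lemma Ball_image3_iff:
  "(\<forall>p\<in>{f x y z | x y z. Q x y z}. P p) \<longleftrightarrow> (\<forall>x y z. Q x y z \<longrightarrow> P (f x y z))"
  by blast

locale relative_separated_graph = separated_graph E C
    for E :: "('v, 'e) pre_digraph" (structure) and C :: "'v \<Rightarrow> 'e set set" +
  fixes S :: "'e set set"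
  assumes S_fin: "S \<subseteq> sep_fin E C"
begin

abbreviation Gens :: "('v, 'e) generator set" where
  "Gens \<equiv> sg_generators E C"

abbreviation Rels :: "(('v, 'e) generator multiset \<times> ('v, 'e) generator multiset) set" where
  "Rels \<equiv> sg_relations E C S"

lemma sep_sets_iff: "X \<in> sep_sets E C \<longleftrightarrow> (\<exists>v\<in>verts E. X \<in> C v)"
  by (auto simp: sep_sets_def)

lemma sep_set_nonempty: "v \<in> verts E \<Longrightarrow> X \<in> C v \<Longrightarrow> X \<noteq> {}"
  using partition by (auto simp: partition_on_def)

lemma sep_set_arc:
  assumes "v \<in> verts E" "X \<in> C v" "e \<in> X"
  shows "e \<in> arcs E" "tail E e = v" "head E e \<in> verts E"
proof -
  have "e \<in> out_arcs E v" using partition[OF assms(1)] assms by (auto simp: partition_on_def)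
  then show "e \<in> arcs E" "tail E e = v" by auto
  then show "head E e \<in> verts E" by simp
qed

text \<open>A nonempty set of edges determines the block that contains it and the vertex of that block.
  This is why a symbol \<open>q'\<^sub>Z\<close> needs to record only \<open>Z\<close>.\<close>

lemma sep_set_unique:
  assumes "v \<in> verts E" "X \<in> C v" "w \<in> verts E" "Y \<in> C w" "e \<in> X" "e \<in> Y"
  shows "v = w" "X = Y"
proof -
  show "v = w" using sep_set_arc(2) assms by metis
  then show "X = Y"
    using partition[OF assms(1)] assms by (auto simp: partition_on_def disjoint_def)
qed

lemma S_sep: "X \<in> S \<Longrightarrow> X \<in> sep_sets E C \<and> finite X"
  using S_fin by (auto simp: sep_fin_def)

lemma quot_set_iff:
  assumes "v \<in> verts E" "X \<in> C v"
  shows "e \<in> quot_set E X H \<longleftrightarrow> e \<in> X \<and> head E e \<notin> H"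
  using sep_set_arc[OF assms] by (auto simp: quot_set_def)

lemma Rest_in_Gens:
  "\<lbrakk>v \<in> verts E; X \<in> C v; Z \<subseteq> X; Z \<noteq> {}; finite Z\<rbrakk> \<Longrightarrow> Rest Z \<in> Gens"
  by (auto simp: sg_generators_def sep_sets_iff)

lemma Vertex_in_Gens [simp]: "Vertex v \<in> Gens \<longleftrightarrow> v \<in> verts E"
  by (auto simp: sg_generators_def)

lemma range_sum_free_words:
  "finite Y \<Longrightarrow> range_sum E Y \<in> free_words T \<longleftrightarrow> (\<forall>e\<in>Y. Vertex (head E e) \<in> T)"
  by (auto simp: range_sum_def free_words_def)

lemma range_sum_in_Gens:
  assumes "v \<in> verts E" "X \<in> C v" "Y \<subseteq> X" "finite Y"
  shows "range_sum E Y \<in> free_words Gens"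
  using assms sep_set_arc(3) by (auto simp: range_sum_free_words)

text \<open>Compatibility for the three families of relations: \<open>v = r(Z) + q'\<^sub>Z\<close>,
  \<open>q'\<^bsub>Z1\<^esub> = r(Z2 - Z1) + q'\<^bsub>Z2\<^esub>\<close>, and \<open>q'\<^sub>X = 0\<close> for \<open>X \<in> S\<close>, where the right-hand side of
  the last is the empty word, whose letters lie in every set.\<close>

lemma compatible_letters_iff:
  "compatible_letters Gens Rels T \<longleftrightarrow> T \<subseteq> Gens \<and>
    (\<forall>v X Z. v \<in> verts E \<and> X \<in> C v \<and> Z \<subseteq> X \<and> Z \<noteq> {} \<and> finite Z \<longrightarrow>
      (Vertex v \<in> T \<longleftrightarrow> (\<forall>e\<in>Z. Vertex (head E e) \<in> T) \<and> Rest Z \<in> T)) \<and>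
    (\<forall>X Z\<^sub>1 Z\<^sub>2. X \<in> sep_sets E C \<and> Z\<^sub>2 \<subseteq> X \<and> finite Z\<^sub>2 \<and> Z\<^sub>1 \<noteq> {} \<and> Z\<^sub>1 \<subset> Z\<^sub>2 \<longrightarrow>
      (Rest Z\<^sub>1 \<in> T \<longleftrightarrow> (\<forall>e\<in>Z\<^sub>2 - Z\<^sub>1. Vertex (head E e) \<in> T) \<and> Rest Z\<^sub>2 \<in> T)) \<and>
    (\<forall>X. X \<in> S \<longrightarrow> Rest X \<in> T)"
  (is "_ \<longleftrightarrow> _ \<and> (\<forall>v X Z. ?Q v X Z \<longrightarrow> ?V v Z) \<and> (\<forall>X Z\<^sub>1 Z\<^sub>2. ?Q' X Z\<^sub>1 Z\<^sub>2 \<longrightarrow> ?R Z\<^sub>1 Z\<^sub>2) \<and> _")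
proof -
  let ?ok = "\<lambda>a b. a \<in> free_words Gens \<longrightarrow> b \<in> free_words Gens \<longrightarrow>
    (a \<in> free_words T \<longleftrightarrow> b \<in> free_words T)"
  have 1: "(?Q v X Z \<longrightarrow> ?ok {#Vertex v#} (range_sum E Z + {#Rest Z#})) \<longleftrightarrow> (?Q v X Z \<longrightarrow> ?V v Z)" for v X Z
  proof (rule imp_cong[OF HOL.refl])
    assume Q: "?Q v X Z"
    then have "Rest Z \<in> Gens" "range_sum E Z \<in> free_words Gens"
      using Rest_in_Gens[of v X Z] range_sum_in_Gens[of v X Z] by auto
    then show "?ok {#Vertex v#} (range_sum E Z + {#Rest Z#}) \<longleftrightarrow> ?V v Z"
      using Q by (simp add: range_sum_free_words conj_commute)
  qed
  have 2: "(?Q' X Z\<^sub>1 Z\<^sub>2 \<longrightarrow> ?ok {#Rest Z\<^sub>1#} (range_sum E (Z\<^sub>2 - Z\<^sub>1) + {#Rest Z\<^sub>2#})) \<longleftrightarrow>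
      (?Q' X Z\<^sub>1 Z\<^sub>2 \<longrightarrow> ?R Z\<^sub>1 Z\<^sub>2)" for X Z\<^sub>1 Z\<^sub>2
  proof (rule imp_cong[OF HOL.refl])
    assume Q: "?Q' X Z\<^sub>1 Z\<^sub>2"
    then obtain v where v: "v \<in> verts E" "X \<in> C v" by (auto simp: sep_sets_iff)
    have "Z\<^sub>1 \<subseteq> X" "finite Z\<^sub>1" "Z\<^sub>2 \<noteq> {}" "Z\<^sub>2 - Z\<^sub>1 \<subseteq> X"
      using Q finite_subset[of Z\<^sub>1 Z\<^sub>2] by auto
    then have "Rest Z\<^sub>1 \<in> Gens" "Rest Z\<^sub>2 \<in> Gens" "range_sum E (Z\<^sub>2 - Z\<^sub>1) \<in> free_words Gens"
      using Q Rest_in_Gens[OF v] range_sum_in_Gens[OF v] by auto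
    then show "?ok {#Rest Z\<^sub>1#} (range_sum E (Z\<^sub>2 - Z\<^sub>1) + {#Rest Z\<^sub>2#}) \<longleftrightarrow> ?R Z\<^sub>1 Z\<^sub>2"
      using Q by (simp add: range_sum_free_words conj_commute)
  qed
  have 3: "(X \<in> S \<longrightarrow> ?ok {#Rest X#} {#}) \<longleftrightarrow> (X \<in> S \<longrightarrow> Rest X \<in> T)" for X
  proof (rule imp_cong[OF HOL.refl])
    assume "X \<in> S"
    then obtain v where v: "v \<in> verts E" "X \<in> C v" "finite X"
      using S_sep[of X] by (auto simp: sep_sets_iff)
    then show "?ok {#Rest X#} {#} \<longleftrightarrow> Rest X \<in> T"
      using Rest_in_Gens[of v X X] sep_set_nonempty[of v X] by simp
  qed
  have all_S: "(\<forall>p\<in>{({#Rest X#}, {#}) | X. X \<in> S}. P p) \<longleftrightarrow> (\<forall>X. X \<in> S \<longrightarrow> P ({#Rest X#}, {#}))"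
    for P :: "('v, 'e) generator multiset \<times> ('v, 'e) generator multiset \<Rightarrow> bool"
    by blast
  show ?thesis
    unfolding compatible_letters_def sg_relations_def
    by (simp only: ball_Un Ball_image3_iff all_S prod.case 1 2 3 conj_assoc)
qed

lemma compatible_VertexD:
  assumes "compatible_letters Gens Rels T" "v \<in> verts E" "X \<in> C v" "Z \<subseteq> X" "Z \<noteq> {}" "finite Z"
  shows "Vertex v \<in> T \<longleftrightarrow> (\<forall>e\<in>Z. Vertex (head E e) \<in> T) \<and> Rest Z \<in> T"
  using assms(1)[unfolded compatible_letters_iff, THEN conjunct2, THEN conjunct1, rule_format,
      of v X Z] assms(2-6) by simp

lemma compatible_RestD:
  assumes "compatible_letters Gens Rels T" "v \<in> verts E" "X \<in> C v"
    "Z\<^sub>2 \<subseteq> X" "finite Z\<^sub>2" "Z\<^sub>1 \<noteq> {}" "Z\<^sub>1 \<subseteq> Z\<^sub>2"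
  shows "Rest Z\<^sub>1 \<in> T \<longleftrightarrow> (\<forall>e\<in>Z\<^sub>2 - Z\<^sub>1. Vertex (head E e) \<in> T) \<and> Rest Z\<^sub>2 \<in> T"
proof (cases "Z\<^sub>1 = Z\<^sub>2")
  case False
  then have "Z\<^sub>1 \<subset> Z\<^sub>2" using assms(7) by blast
  moreover have "X \<in> sep_sets E C" using assms(2,3) by (auto simp: sep_sets_iff)
  ultimately show ?thesis
    using assms(1)[unfolded compatible_letters_iff, THEN conjunct2, THEN conjunct2, THEN conjunct1,
        rule_format, of X Z\<^sub>2 Z\<^sub>1] assms(4-6) by simp
qed simp

lemma compatible_SD: "compatible_letters Gens Rels T \<Longrightarrow> X \<in> S \<Longrightarrow> Rest X \<in> T"
  by (simp add: compatible_letters_iff)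


section \<open>Admissible pairs and compatible letters\<close>

definition admissible :: "'v set \<Rightarrow> 'e set set \<Rightarrow> bool" where
  "admissible H G \<longleftrightarrow>
    hereditary E H \<and> saturated E C S H \<and> G \<subseteq> breaking_sets E C S H"

text \<open>The generators contained in the order-ideal of \<open>(H, G)\<close>. A symbol \<open>q'\<^sub>Z\<close> belongs to it either
  because \<open>q'\<^sub>Z \<le> v \<in> H\<close> or because, modulo \<open>H\<close>, it equals \<open>q'\<^bsub>X/H\<^esub>\<close> (if \<open>X \<in> G\<close>) or
  \<open>q'\<^sub>X = 0\<close> (if \<open>X \<in> S\<close>). Finite and infinite \<open>X\<close> are treated alike: for finite \<open>X\<close> the symbols
  \<open>q'\<^sub>X\<close> and \<open>q'\<^bsub>X/H\<^esub>\<close> agree modulo \<open>H\<close>.\<close>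

definition pair_letters :: "'v set \<Rightarrow> 'e set set \<Rightarrow> ('v, 'e) generator set" where
  "pair_letters H G = Vertex ` H \<union>
    {Rest Z | v X Z. v \<in> verts E \<and> X \<in> C v \<and> Z \<subseteq> X \<and> Z \<noteq> {} \<and> finite Z \<and>
      (v \<in> H \<or> quot_set E X H \<subseteq> Z \<and> X \<in> G \<union> S)}"

definition letter_verts :: "('v, 'e) generator set \<Rightarrow> 'v set" where
  "letter_verts T = {v \<in> verts E. Vertex v \<in> T}"

definition letter_sets :: "('v, 'e) generator set \<Rightarrow> 'e set set" where
  "letter_sets T = {X \<in> breaking_sets E C S (letter_verts T). Rest (quot_set E X (letter_verts T)) \<in> T}"

lemma Vertex_in_pair_letters [simp]: "Vertex v \<in> pair_letters H G \<longleftrightarrow> v \<in> H"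
  by (auto simp: pair_letters_def)

text \<open>The block \<open>X\<close> and the vertex \<open>v\<close>, existentially quantified in the definition, may be fixed in
  advance because \<open>Z\<close> determines them.\<close>

lemma Rest_in_pair_letters:
  assumes "v \<in> verts E" "X \<in> C v" "Z \<subseteq> X" "Z \<noteq> {}" "finite Z"
  shows "Rest Z \<in> pair_letters H G \<longleftrightarrow> v \<in> H \<or> quot_set E X H \<subseteq> Z \<and> X \<in> G \<union> S"
proof
  assume "Rest Z \<in> pair_letters H G"
  then obtain w Y where w: "w \<in> verts E" "Y \<in> C w" "Z \<subseteq> Y"
    and d: "w \<in> H \<or> quot_set E Y H \<subseteq> Z \<and> Y \<in> G \<union> S"
    by (auto simp: pair_letters_def)
  obtain e where "e \<in> Z" using assms(4) by blast
  then have "w = v" "Y = X"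
    using sep_set_unique[OF w(1,2) assms(1,2), of e] w(3) assms(3) by auto
  then show "v \<in> H \<or> quot_set E X H \<subseteq> Z \<and> X \<in> G \<union> S" using d by simp
next
  assume "v \<in> H \<or> quot_set E X H \<subseteq> Z \<and> X \<in> G \<union> S"
  then show "Rest Z \<in> pair_letters H G"
    unfolding pair_letters_def using assms by blast
qed

lemma hereditary_head:
  assumes "hereditary E H" "v \<in> verts E" "X \<in> C v" "e \<in> X" "v \<in> H"
  shows "head E e \<in> H"
proof -
  have "(tail E e, head E e) \<in> arcs_ends E"
    unfolding arcs_ends_def arc_to_ends_def using sep_set_arc(1)[OF assms(2-4)] by (rule imageI)
  then have "v \<rightarrow>\<^sup>* head E e"
    using sep_set_arc(2)[OF assms(2-4)] by (intro reachable_adjI) simp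
  then show ?thesis using assms(1,5) unfolding hereditary_def by blast
qed

lemma breaking_set_vertex_notin:
  assumes "hereditary E H" "X \<in> breaking_sets E C S H" "v \<in> verts E" "X \<in> C v"
  shows "v \<notin> H"
proof
  assume "v \<in> H"
  then have "quot_set E X H = {}"
    using hereditary_head[OF assms(1,3,4)] by (auto simp: quot_set_def)
  then show False using assms(2) by (simp add: breaking_sets_def)
qed

text \<open>Heredity of \<open>H\<close> gives the passage from left to right in the relations for \<open>v\<close> and \<open>q'\<^bsub>Z1\<^esub>\<close>.
  Saturation enters once: if \<open>r(Z)\<close> lies in \<open>H\<close> and \<open>X/H \<subseteq> Z\<close>, then \<open>X/H\<close> is empty, so \<open>X\<close>
  cannot belong to \<open>G\<close>; it belongs to \<open>S\<close> and forces \<open>v \<in> H\<close>.\<close>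

lemma compatible_pair_letters:
  assumes "admissible H G"
  shows "compatible_letters Gens Rels (pair_letters H G)"
proof -
  let ?T = "pair_letters H G"
  have her: "hereditary E H" and sat: "saturated E C S H" and G: "G \<subseteq> breaking_sets E C S H"
    using assms by (auto simp: admissible_def)
  have "H \<subseteq> verts E" using her by (simp add: hereditary_def)
  then have sub: "?T \<subseteq> Gens"
    using Rest_in_Gens by (auto simp: pair_letters_def)
  have 1: "Vertex v \<in> ?T \<longleftrightarrow> (\<forall>e\<in>Z. Vertex (head E e) \<in> ?T) \<and> Rest Z \<in> ?T"
    if "v \<in> verts E \<and> X \<in> C v \<and> Z \<subseteq> X \<and> Z \<noteq> {} \<and> finite Z" for v X Z
  proof -
    have vX: "v \<in> verts E" "X \<in> C v" "Z \<subseteq> X" "Z \<noteq> {}" "finite Z" using that by auto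
    have "v \<in> H" if Z: "\<forall>e\<in>Z. head E e \<in> H" and q: "quot_set E X H \<subseteq> Z" "X \<in> G \<union> S"
    proof -
      have emp: "quot_set E X H = {}" using Z q(1) quot_set_iff[OF vX(1,2)] by blast
      then have "X \<in> S" using q(2) G by (auto simp: breaking_sets_def)
      moreover have "head E ` X \<subseteq> H" using emp quot_set_iff[OF vX(1,2)] by blast
      ultimately show ?thesis using sat vX(1,2) by (auto simp: saturated_def)
    qed
    moreover have "head E e \<in> H" if "v \<in> H" "e \<in> Z" for e
      using hereditary_head[OF her] vX that by blast
    ultimately show ?thesis
      unfolding Rest_in_pair_letters[OF vX] Vertex_in_pair_letters by blast
  qed
  have 2: "Rest Z\<^sub>1 \<in> ?T \<longleftrightarrow> (\<forall>e\<in>Z\<^sub>2 - Z\<^sub>1. Vertex (head E e) \<in> ?T) \<and> Rest Z\<^sub>2 \<in> ?T"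
    if Q: "X \<in> sep_sets E C \<and> Z\<^sub>2 \<subseteq> X \<and> finite Z\<^sub>2 \<and> Z\<^sub>1 \<noteq> {} \<and> Z\<^sub>1 \<subset> Z\<^sub>2" for X Z\<^sub>1 Z\<^sub>2
  proof -
    obtain v where vX: "v \<in> verts E" "X \<in> C v" using Q by (auto simp: sep_sets_iff)
    have Z: "Z\<^sub>2 \<subseteq> X" "finite Z\<^sub>2" "Z\<^sub>1 \<noteq> {}" "Z\<^sub>1 \<subset> Z\<^sub>2" using Q by auto
    have Z': "Z\<^sub>1 \<subseteq> X" "finite Z\<^sub>1" "Z\<^sub>2 \<noteq> {}" using Z finite_subset by auto
    have "head E e \<in> H" if "v \<in> H" "e \<in> Z\<^sub>2 - Z\<^sub>1" for e
      using hereditary_head[OF her] vX Z that by blast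
    moreover have "quot_set E X H \<subseteq> Z\<^sub>1 \<longleftrightarrow>
        (\<forall>e\<in>Z\<^sub>2 - Z\<^sub>1. head E e \<in> H) \<and> quot_set E X H \<subseteq> Z\<^sub>2"
      using Z quot_set_iff[OF vX] by blast
    ultimately show ?thesis
      unfolding Rest_in_pair_letters[OF vX Z'(1) Z(3) Z'(2)] Rest_in_pair_letters[OF vX Z(1) Z'(3) Z(2)]
        Vertex_in_pair_letters
      by blast
  qed
  have 3: "Rest X \<in> ?T" if X: "X \<in> S" for X
  proof -
    obtain v where vX: "v \<in> verts E" "X \<in> C v" "finite X"
      using S_sep[OF X] by (auto simp: sep_sets_iff)
    then show ?thesis
      using Rest_in_pair_letters[OF vX(1,2) order.refl sep_set_nonempty[OF vX(1,2)] vX(3)] X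
      by (simp add: quot_set_def)
  qed
  show ?thesis
    unfolding compatible_letters_iff
    by (intro conjI allI impI sub) (erule 1 2 3)+
qed

text \<open>An edge \<open>e\<close> leaving \<open>v\<close> gives the relation \<open>v = r(e) + q'\<^bsub>{e}\<^esub>\<close>, hence heredity along paths.
  Saturation comes from \<open>v = r(X) + q'\<^sub>X\<close> and \<open>q'\<^sub>X = 0\<close> for \<open>X \<in> S\<close>.\<close>

lemma admissible_letters:
  assumes T: "compatible_letters Gens Rels T"
  shows "admissible (letter_verts T) (letter_sets T)"
proof -
  let ?H = "letter_verts T"
  have step: "w \<in> ?H" if v: "v \<in> ?H" and a: "v \<rightarrow> w" for v w
  proof -
    obtain e where e: "e \<in> arcs E" "tail E e = v" "head E e = w"
      using a by (auto simp: arcs_ends_def arc_to_ends_def)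
    have vv: "v \<in> verts E" using v by (simp add: letter_verts_def)
    have "e \<in> \<Union>(C v)"
      using partition_onD1[OF partition[OF vv]] e by auto
    then obtain X where X: "X \<in> C v" "e \<in> X" by blast
    have "Vertex w \<in> T"
      using compatible_VertexD[OF T vv X(1), of "{e}"] X e v by (auto simp: letter_verts_def)
    then show ?thesis using e by (auto simp: letter_verts_def)
  qed
  have "w \<in> ?H" if "v \<rightarrow>\<^sup>* w" "v \<in> ?H" for v w
    using that by (induction rule: reachable_induct) (auto intro: step)
  then have "hereditary E ?H"
    by (auto simp: hereditary_def letter_verts_def)
  moreover have "saturated E C S ?H"
  proof -
    have "v \<in> ?H" if v: "v \<in> verts E" and X: "X \<in> S" "X \<in> C v" "head E ` X \<subseteq> ?H" for v X
      using compatible_VertexD[OF T v X(2), of X] sep_set_nonempty[OF v X(2)] S_sep[OF X(1)]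
        compatible_SD[OF T X(1)] X(3) v by (auto simp: letter_verts_def)
    then show ?thesis by (auto simp: saturated_def)
  qed
  ultimately show ?thesis by (auto simp: admissible_def letter_sets_def)
qed

text \<open>The letters of \<open>(H, G)\<close> are forced by \<open>H\<close> together with one symbol for each \<open>X \<in> G\<close>. The
  symbol may be \<open>q'\<^sub>X\<close> or \<open>q'\<^bsub>X/H\<^esub>\<close>, so that the lemma applies both to the generators of
  \<open>I(H, G)\<close>, where the choice depends on the finiteness of \<open>X\<close>, and to comparisons of two pairs,
  where only \<open>q'\<^bsub>X/H\<^esub>\<close> is used.\<close>

lemma pair_letters_subset:
  assumes T: "compatible_letters Gens Rels T"
    and H: "Vertex ` H \<subseteq> T"
    and G: "\<And>X. X \<in> G \<Longrightarrow> quot_set E X H \<noteq> {} \<and> (Rest (quot_set E X H) \<in> T \<or> finite X \<and> Rest X \<in> T)"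
  shows "pair_letters H G \<subseteq> T"
proof -
  have "Rest Z \<in> T" if vX: "v \<in> verts E" "X \<in> C v" and Z: "Z \<subseteq> X" "Z \<noteq> {}" "finite Z"
    and d: "v \<in> H \<or> quot_set E X H \<subseteq> Z \<and> X \<in> G \<union> S" for v X Z
  proof (cases "v \<in> H")
    case True
    then have "Vertex v \<in> T" using H by blast
    then show ?thesis using compatible_VertexD[OF T vX Z] by simp
  next
    case False
    then have q: "quot_set E X H \<subseteq> Z" and "X \<in> G \<union> S" using d by auto
    then consider "quot_set E X H \<noteq> {}" "Rest (quot_set E X H) \<in> T" | "finite X" "Rest X \<in> T"
      using G[of X] S_sep[of X] compatible_SD[OF T, of X] by auto
    then show ?thesis
    proof cases
      case 1
      then show ?thesis
        using compatible_RestD[OF T vX Z(1,3) 1(1) q] by simp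
    next
      case 2
      have "Vertex (head E e) \<in> T" if "e \<in> X - Z" for e
        using that q H quot_set_iff[OF vX] by blast
      then show ?thesis
        using compatible_RestD[OF T vX order.refl 2(1) Z(2,1)] 2(2) by simp
    qed
  qed
  then show ?thesis using H by (auto simp: pair_letters_def)
qed

text \<open>That every letter of \<open>T\<close> is accounted for is the heart of the classification: a symbol \<open>q'\<^sub>Z\<close>
  in \<open>T\<close> whose vertex is not in \<open>T\<close> forces \<open>X/H\<close> to be a nonempty subset of \<open>Z\<close>, in particular
  finite, so \<open>X\<close> lies in \<open>S\<close> or in \<open>\<G>(H)\<close>.\<close>

lemma pair_letters_letter_pair:
  assumes T: "compatible_letters Gens Rels T"
  shows "pair_letters (letter_verts T) (letter_sets T) = T"
proof
  let ?H = "letter_verts T" and ?G = "letter_sets T"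
  show "pair_letters ?H ?G \<subseteq> T"
    by (rule pair_letters_subset[OF T])
      (auto simp: letter_verts_def letter_sets_def breaking_sets_def)
  show "T \<subseteq> pair_letters ?H ?G"
  proof
    fix g assume g: "g \<in> T"
    then have "g \<in> Gens" using T by (auto simp: compatible_letters_def)
    then consider v where "g = Vertex v" "v \<in> verts E"
      | Z v X where "g = Rest Z" "v \<in> verts E" "X \<in> C v" "Z \<subseteq> X" "Z \<noteq> {}" "finite Z"
      by (auto simp: sg_generators_def sep_sets_iff)
    then show "g \<in> pair_letters ?H ?G"
    proof cases
      case 1
      then show ?thesis using g by (simp add: letter_verts_def)
    next
      case (2 Z v X)
      note vX = 2(2,3) and Z = 2(4-6)
      let ?Q = "quot_set E X ?H"
      have head: "e \<in> ?Q \<longleftrightarrow> e \<in> X \<and> Vertex (head E e) \<notin> T" for e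
        using quot_set_iff[OF vX] sep_set_arc(3)[OF vX] by (auto simp: letter_verts_def)
      have QZ: "?Q \<subseteq> Z"
      proof
        \<comment> \<open>If \<open>e\<close> were outside \<open>Z\<close>, then \<open>q'\<^sub>Z = r(e) + q'\<^sub>W\<close> with \<open>W = Z \<union> {e}\<close> would put \<open>r(e)\<close> into \<open>T\<close>.\<close>
        fix e assume e: "e \<in> ?Q"
        show "e \<in> Z"
        proof (rule ccontr)
          assume "e \<notin> Z"
          then show False
            using compatible_RestD[OF T vX, of "insert e Z" Z] Z e g 2(1) head by auto
        qed
      qed
      have "X \<in> ?G \<union> S" if v: "v \<notin> ?H"
      proof -
        have "Vertex v \<notin> T" using v vX by (simp add: letter_verts_def)
        \<comment> \<open>Otherwise \<open>v = r(Z) + q'\<^sub>Z\<close> would put \<open>v\<close> into \<open>T\<close>.\<close>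
        then have ne: "?Q \<noteq> {}"
          using compatible_VertexD[OF T vX Z] g 2(1) head Z(1) by blast
        have "Rest ?Q \<in> T"
          using compatible_RestD[OF T vX Z(1,3) ne QZ] g 2(1) head Z(1) by blast
        then show ?thesis
          using ne finite_subset[OF QZ Z(3)] vX
          by (auto simp: letter_sets_def breaking_sets_def sep_sets_iff)
      qed
      then show ?thesis
        using Rest_in_pair_letters[OF vX Z] QZ 2(1) by auto
    qed
  qed
qed

lemma letter_verts_pair_letters:
  "admissible H G \<Longrightarrow> letter_verts (pair_letters H G) = H"
  by (auto simp: letter_verts_def admissible_def hereditary_def)

lemma Rest_quot_in_pair_letters:
  assumes "X \<in> breaking_sets E C S K" "v \<in> verts E" "X \<in> C v"
  shows "Rest (quot_set E X K) \<in> pair_letters H G \<longleftrightarrow>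
    v \<in> H \<or> quot_set E X H \<subseteq> quot_set E X K \<and> X \<in> G"
proof -
  have "quot_set E X K \<subseteq> X" "quot_set E X K \<noteq> {}" "finite (quot_set E X K)" "X \<notin> S"
    using assms(1) by (auto simp: breaking_sets_def quot_set_def)
  then show ?thesis using Rest_in_pair_letters[OF assms(2,3)] by auto
qed

lemma letter_sets_pair_letters:
  assumes HG: "admissible H G"
  shows "letter_sets (pair_letters H G) = G"
proof -
  have "Rest (quot_set E X H) \<in> pair_letters H G \<longleftrightarrow> X \<in> G"
    if X: "X \<in> breaking_sets E C S H" for X
  proof -
    obtain v where v: "v \<in> verts E" "X \<in> C v"
      using X by (auto simp: breaking_sets_def sep_sets_iff)
    have "v \<notin> H" using breaking_set_vertex_notin[OF _ X v] HG by (simp add: admissible_def)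
    then show ?thesis using Rest_quot_in_pair_letters[OF X v] by simp
  qed
  moreover have "G \<subseteq> breaking_sets E C S H" using HG by (simp add: admissible_def)
  ultimately show ?thesis
    unfolding letter_sets_def letter_verts_pair_letters[OF HG] by blast
qed

text \<open>The summand \<open>C[H\<^sub>2]\<close> appears because a block \<open>X \<in> G\<^sub>1\<close> whose vertex has entered \<open>H\<^sub>2\<close> has all
  its symbols in the larger ideal, yet is not in \<open>\<G>(H\<^sub>2)\<close> since \<open>X/H\<^sub>2\<close> is empty.\<close>

lemma pair_letters_mono_iff:
  assumes A1: "admissible H\<^sub>1 G\<^sub>1" and A2: "admissible H\<^sub>2 G\<^sub>2"
  shows "pair_letters H\<^sub>1 G\<^sub>1 \<subseteq> pair_letters H\<^sub>2 G\<^sub>2 \<longleftrightarrow>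
    H\<^sub>1 \<subseteq> H\<^sub>2 \<and> G\<^sub>1 \<subseteq> G\<^sub>2 \<union> sep_over C H\<^sub>2" (is "?L \<longleftrightarrow> ?R")
proof -
  have H2: "H\<^sub>2 \<subseteq> verts E" using A2 by (simp add: admissible_def hereditary_def)
  have G1: "\<exists>v\<in>verts E. X \<in> C v \<and> X \<in> breaking_sets E C S H\<^sub>1" if "X \<in> G\<^sub>1" for X
    using that A1 by (auto simp: admissible_def breaking_sets_def sep_sets_iff)
  have over: "v \<in> H\<^sub>2" if "v \<in> verts E" "X \<in> C v" "X \<in> sep_over C H\<^sub>2" for v X
    using that H2 sep_set_unique(1) sep_set_nonempty by (auto simp: sep_over_def) blast
  show ?thesis
  proof
    assume L: ?L
    have "H\<^sub>1 \<subseteq> H\<^sub>2" using L Vertex_in_pair_letters by blast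
    moreover have "X \<in> G\<^sub>2 \<union> sep_over C H\<^sub>2" if X: "X \<in> G\<^sub>1" for X
    proof -
      obtain v where v: "v \<in> verts E" "X \<in> C v" "X \<in> breaking_sets E C S H\<^sub>1"
        using G1[OF X] by blast
      have "Rest (quot_set E X H\<^sub>1) \<in> pair_letters H\<^sub>2 G\<^sub>2"
        using L X Rest_quot_in_pair_letters[OF v(3,1,2), of H\<^sub>1 G\<^sub>1] by blast
      then show ?thesis
        using Rest_quot_in_pair_letters[OF v(3,1,2)] v by (auto simp: sep_over_def)
    qed
    ultimately show ?R by blast
  next
    assume R: ?R
    show ?L
    proof (rule pair_letters_subset[OF compatible_pair_letters[OF A2]])
      show "Vertex ` H\<^sub>1 \<subseteq> pair_letters H\<^sub>2 G\<^sub>2" using R by auto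
      fix X assume X: "X \<in> G\<^sub>1"
      then obtain v where v: "v \<in> verts E" "X \<in> C v" "X \<in> breaking_sets E C S H\<^sub>1"
        using G1 by blast
      have "quot_set E X H\<^sub>2 \<subseteq> quot_set E X H\<^sub>1" using R by (auto simp: quot_set_def)
      then have "Rest (quot_set E X H\<^sub>1) \<in> pair_letters H\<^sub>2 G\<^sub>2"
        using Rest_quot_in_pair_letters[OF v(3,1,2)] R X over[OF v(1,2)] by blast
      then show "quot_set E X H\<^sub>1 \<noteq> {} \<and> (Rest (quot_set E X H\<^sub>1) \<in> pair_letters H\<^sub>2 G\<^sub>2 \<or>
          finite X \<and> Rest X \<in> pair_letters H\<^sub>2 G\<^sub>2)"
        using v(3) by (auto simp: breaking_sets_def)
    qed
  qed
qed


section \<open>Admissible pairs and order-ideals\<close>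

abbreviation pair_ideal :: "'v set \<Rightarrow> 'e set set \<Rightarrow> ('v, 'e) generator multiset set set" where
  "pair_ideal H G \<equiv> words_ideal Gens Rels (pair_letters H G)"

lemma order_ideal_pair_ideal:
  "admissible H G \<Longrightarrow> order_ideal (pair_ideal H G) (sg_monoid E C S)"
  unfolding sg_monoid_def by (intro order_ideal_words_ideal compatible_pair_letters)

text \<open>The submonoid \<open>I(H, G)\<close> and the ideal with letters \<open>pair_letters H G\<close> have the same order-ideals
  above them, so the latter is the order-ideal generated by the former.\<close>

lemma pair_submonoid_subset_iff:
  assumes I: "order_ideal I (sg_monoid E C S)" and A: "admissible H G"
  shows "pair_submonoid E C S H G \<subseteq> I \<longleftrightarrow> pair_ideal H G \<subseteq> I"
proof -
  let ?T = "ideal_letters Gens Rels I"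
  have I': "order_ideal I (pres_monoid Gens Rels)" using I by (simp add: sg_monoid_def)
  note T = compatible_ideal_letters[OF I']
  have HG: "H \<subseteq> verts E" "G \<subseteq> breaking_sets E C S H"
    using A by (auto simp: admissible_def hereditary_def)
  have sep: "\<exists>v\<in>verts E. X \<in> C v \<and> quot_set E X H \<noteq> {} \<and> finite (quot_set E X H) \<and> quot_set E X H \<subseteq> X"
    if "X \<in> G" for X
    using that HG by (auto simp: breaking_sets_def sep_sets_iff quot_set_def)
  have vert: "vertex_elt E C S v \<in> I \<longleftrightarrow> Vertex v \<in> ?T" if "v \<in> H" for v
    using that HG by (auto simp: vertex_elt_def ideal_letters_def)
  have fin: "rest_elt E C S X \<in> I \<longleftrightarrow> Rest X \<in> ?T" if "X \<in> sep_fin E C \<inter> G" for X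
    using that sep Rest_in_Gens[of _ X X] sep_set_nonempty
    by (fastforce simp: rest_elt_def ideal_letters_def sep_fin_def)
  have inf: "rest_elt E C S (quot_set E X H) \<in> I \<longleftrightarrow> Rest (quot_set E X H) \<in> ?T"
    if "X \<in> G" for X
    using sep[OF that] Rest_in_Gens by (auto simp: rest_elt_def ideal_letters_def)
  have "submonoid I (sg_monoid E C S)" using I by (simp add: order_ideal_def)
  then have "pair_submonoid E C S H G \<subseteq> I \<longleftrightarrow>
    (\<forall>v\<in>H. vertex_elt E C S v \<in> I) \<and> (\<forall>X\<in>sep_fin E C \<inter> G. rest_elt E C S X \<in> I) \<and>
    (\<forall>X\<in>sep_inf E C \<inter> G. rest_elt E C S (quot_set E X H) \<in> I)"
    unfolding pair_submonoid_def gen_submonoid_subset_iff[OF \<open>submonoid I _\<close>] by blast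
  also have "\<dots> \<longleftrightarrow> (\<forall>v\<in>H. Vertex v \<in> ?T) \<and> (\<forall>X\<in>sep_fin E C \<inter> G. Rest X \<in> ?T) \<and>
    (\<forall>X\<in>sep_inf E C \<inter> G. Rest (quot_set E X H) \<in> ?T)"
    using vert fin inf by auto
  also have "\<dots> \<longleftrightarrow> pair_letters H G \<subseteq> ?T" (is "?B \<longleftrightarrow> _")
  proof
    assume B: ?B
    show "pair_letters H G \<subseteq> ?T"
    proof (rule pair_letters_subset[OF T])
      fix X assume X: "X \<in> G"
      then have "X \<in> sep_fin E C \<or> X \<in> sep_inf E C"
        using HG by (auto simp: breaking_sets_def sep_inf_def)
      then show "quot_set E X H \<noteq> {} \<and> (Rest (quot_set E X H) \<in> ?T \<or> finite X \<and> Rest X \<in> ?T)"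
        using B sep[OF X] X by (auto simp: sep_fin_def)
    qed (use B in auto)
  next
    assume L: "pair_letters H G \<subseteq> ?T"
    have "Rest X \<in> pair_letters H G" if X: "X \<in> sep_fin E C \<inter> G" for X
    proof -
      obtain v where v: "v \<in> verts E" "X \<in> C v" "quot_set E X H \<subseteq> X" using sep X by blast
      then show ?thesis
        using Rest_in_pair_letters[OF v(1,2), of X] sep_set_nonempty[OF v(1,2)] X
        by (simp add: sep_fin_def)
    qed
    moreover have "Rest (quot_set E X H) \<in> pair_letters H G" if X: "X \<in> G" for X
      using sep[OF X] Rest_in_pair_letters[of _ X "quot_set E X H"] X by blast
    ultimately show ?B using L Vertex_in_pair_letters by blast
  qed
  also have "\<dots> \<longleftrightarrow> pair_ideal H G \<subseteq> I"
    using words_ideal_subset_iff[OF compatible_pair_letters[OF A] I'] by simp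
  finally show ?thesis .
qed

lemma gen_order_ideal_pair_submonoid:
  assumes "admissible H G"
  shows "gen_order_ideal (sg_monoid E C S) (pair_submonoid E C S H G) = pair_ideal H G"
  using pair_submonoid_subset_iff[OF _ assms] order_ideal_pair_ideal[OF assms]
  unfolding gen_order_ideal_def by blast

lemma ideal_vertex_set:
  "{v \<in> verts E. vertex_elt E C S v \<in> I} = letter_verts (ideal_letters Gens Rels I)"
  by (auto simp: letter_verts_def ideal_letters_def vertex_elt_def)

text \<open>For finite \<open>X\<close> the edges of \<open>X\<close> outside \<open>X/H\<close> end in \<open>H\<close>, so that \<open>q'\<^sub>X \<in> I\<close> if and only if
  \<open>q'\<^bsub>X/H\<^esub> \<in> I\<close>; the separate tests for finite and infinite \<open>X\<close> collapse to one.\<close>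

lemma ideal_breaking_sets:
  assumes I: "order_ideal I (sg_monoid E C S)"
    and H: "H = letter_verts (ideal_letters Gens Rels I)"
  shows "{X \<in> breaking_sets E C S H \<inter> sep_fin E C. rest_elt E C S X \<in> I} \<union>
      {X \<in> breaking_sets E C S H \<inter> sep_inf E C. rest_elt E C S (quot_set E X H) \<in> I} =
    letter_sets (ideal_letters Gens Rels I)"
proof -
  let ?T = "ideal_letters Gens Rels I"
  have T: "compatible_letters Gens Rels ?T"
    using compatible_ideal_letters I by (simp add: sg_monoid_def)
  have inf: "rest_elt E C S (quot_set E X H) \<in> I \<longleftrightarrow> Rest (quot_set E X H) \<in> ?T"
    and fin: "finite X \<Longrightarrow> rest_elt E C S X \<in> I \<longleftrightarrow> Rest (quot_set E X H) \<in> ?T"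
    if X: "X \<in> breaking_sets E C S H" for X
  proof -
    obtain v where v: "v \<in> verts E" "X \<in> C v" "X \<noteq> {}"
      using X sep_set_nonempty by (auto simp: breaking_sets_def sep_sets_iff)
    have Q: "quot_set E X H \<subseteq> X" "quot_set E X H \<noteq> {}" "finite (quot_set E X H)"
      using X by (auto simp: breaking_sets_def quot_set_def)
    show "rest_elt E C S (quot_set E X H) \<in> I \<longleftrightarrow> Rest (quot_set E X H) \<in> ?T"
      using Rest_in_Gens[OF v(1,2) Q] by (simp add: rest_elt_def ideal_letters_def)
    assume f: "finite X"
    have "Vertex (head E e) \<in> ?T" if "e \<in> X - quot_set E X H" for e
      using that quot_set_iff[OF v(1,2)] by (auto simp: H letter_verts_def)
    then have "Rest (quot_set E X H) \<in> ?T \<longleftrightarrow> Rest X \<in> ?T"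
      using compatible_RestD[OF T v(1,2) order.refl f Q(2,1)] by blast
    then show "rest_elt E C S X \<in> I \<longleftrightarrow> Rest (quot_set E X H) \<in> ?T"
      using Rest_in_Gens[OF v(1,2) order.refl v(3) f] by (simp add: rest_elt_def ideal_letters_def)
  qed
  have "X \<in> sep_fin E C \<and> finite X \<or> X \<in> sep_inf E C" if "X \<in> breaking_sets E C S H" for X
    using that by (auto simp: breaking_sets_def sep_inf_def sep_fin_def)
  then show ?thesis
    using inf fin unfolding letter_sets_def H[symmetric] by (auto simp: sep_fin_def)
qed

end


section \<open>The isomorphism\<close>


theorem theorem6p9:
  fixes E :: "('v, 'e) pre_digraph"
    and C :: "'v \<Rightarrow> 'e set set"
    and S :: "'e set set"
  assumes "separated_graph E C"
    and "S \<subseteq> sep_fin E C"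
  shows "\<exists>\<phi> \<psi>.
    lattice_iso (admissible_pairs E C S) (order_ideal_lattice (sg_monoid E C S)) \<phi> \<and>
    lattice_iso (order_ideal_lattice (sg_monoid E C S)) (admissible_pairs E C S) \<psi> \<and>
    (\<forall>p \<in> carrier (admissible_pairs E C S). \<psi> (\<phi> p) = p) \<and>
    (\<forall>I \<in> carrier (order_ideal_lattice (sg_monoid E C S)). \<phi> (\<psi> I) = I) \<and>
    (\<forall>(H, G) \<in> carrier (admissible_pairs E C S).
      \<phi> (H, G) = gen_order_ideal (sg_monoid E C S) (pair_submonoid E C S H G)) \<and>
    (\<forall>I \<in> carrier (order_ideal_lattice (sg_monoid E C S)).
      \<psi> I = (let H = {v \<in> verts E. vertex_elt E C S v \<in> I} in
        (H,
         {X \<in> breaking_sets E C S H \<inter> sep_fin E C. rest_elt E C S X \<in> I} \<union>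
         {X \<in> breaking_sets E C S H \<inter> sep_inf E C. rest_elt E C S (quot_set E X H) \<in> I})))"
proof -
  interpret relative_separated_graph E C S
    using assms by (simp add: relative_separated_graph_def relative_separated_graph_axioms_def)
  let ?M = "sg_monoid E C S"
  let ?A = "admissible_pairs E C S" and ?L = "order_ideal_lattice ?M"
  let ?letters = "ideal_letters Gens Rels"
  define \<phi> where "\<phi> = (\<lambda>(H, G). gen_order_ideal ?M (pair_submonoid E C S H G))"
  define \<psi> where "\<psi> = (\<lambda>I. let H = {v \<in> verts E. vertex_elt E C S v \<in> I} in
    (H, {X \<in> breaking_sets E C S H \<inter> sep_fin E C. rest_elt E C S X \<in> I} \<union>
        {X \<in> breaking_sets E C S H \<inter> sep_inf E C. rest_elt E C S (quot_set E X H) \<in> I}))"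
  have A: "(H, G) \<in> carrier ?A \<longleftrightarrow> admissible H G" for H G
    by (simp add: admissible_pairs_def admissible_def)
  have L: "I \<in> carrier ?L \<longleftrightarrow> order_ideal I ?M" for I
    by (simp add: order_ideal_lattice_def)
  have phi: "\<phi> (H, G) = pair_ideal H G" if "admissible H G" for H G
    using gen_order_ideal_pair_submonoid[OF that] by (simp add: \<phi>_def)
  have psi: "\<psi> I = (letter_verts (?letters I), letter_sets (?letters I))"
    if "order_ideal I ?M" for I
    using ideal_breaking_sets[OF that] by (simp add: \<psi>_def ideal_vertex_set Let_def)
  have compat: "compatible_letters Gens Rels (?letters I)" if "order_ideal I ?M" for I
    using that compatible_ideal_letters by (simp add: sg_monoid_def)
  have phi_in: "\<phi> p \<in> carrier ?L" if "p \<in> carrier ?A" for p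
    using that by (cases p) (simp add: A L phi order_ideal_pair_ideal)
  have psi_in: "\<psi> I \<in> carrier ?A" if "I \<in> carrier ?L" for I
    using that by (simp add: A L psi admissible_letters compat)
  have psi_phi: "\<psi> (\<phi> p) = p" if "p \<in> carrier ?A" for p
    using that by (cases p)
      (simp add: A phi psi order_ideal_pair_ideal ideal_letters_words_ideal compatible_pair_letters
        letter_verts_pair_letters letter_sets_pair_letters)
  have phi_psi: "\<phi> (\<psi> I) = I" if "I \<in> carrier ?L" for I
  proof -
    have "order_ideal I ?M" using that L by simp
    then show ?thesis
      using words_ideal_ideal_letters[of I Gens Rels]
      by (simp add: phi psi admissible_letters compat pair_letters_letter_pair sg_monoid_def)
  qed
  have phi_le: "le ?L (\<phi> p) (\<phi> q) \<longleftrightarrow> le ?A p q"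
    if "p \<in> carrier ?A" "q \<in> carrier ?A" for p q
  proof -
    obtain H G H' G' where pq: "p = (H, G)" "q = (H', G')" by (metis surj_pair)
    then have ad: "admissible H G" "admissible H' G'" using that A by auto
    have "pair_ideal H G \<subseteq> pair_ideal H' G' \<longleftrightarrow> pair_letters H G \<subseteq> pair_letters H' G'"
      using words_ideal_subset_iff[OF compatible_pair_letters[OF ad(1)],
          of "pair_ideal H' G'"] order_ideal_pair_ideal[OF ad(2)] ideal_letters_words_ideal[OF compatible_pair_letters[OF ad(2)]]
      by (simp add: sg_monoid_def)
    then show ?thesis
      using ad pair_letters_mono_iff[OF ad]
      by (simp add: pq phi order_ideal_lattice_def admissible_pairs_def)
  qed
  have psi_le: "le ?A (\<psi> I) (\<psi> J) \<longleftrightarrow> le ?L I J"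
    if "I \<in> carrier ?L" "J \<in> carrier ?L" for I J
    using phi_le[OF psi_in[OF that(1)] psi_in[OF that(2)]] phi_psi that by simp
  have bij_phi: "bij_betw \<phi> (carrier ?A) (carrier ?L)"
    by (rule bij_betw_byWitness[where f' = \<psi>]) (use phi_psi psi_phi phi_in psi_in in auto)
  have bij_psi: "bij_betw \<psi> (carrier ?L) (carrier ?A)"
    by (rule bij_betw_byWitness[where f' = \<phi>]) (use phi_psi psi_phi phi_in psi_in in auto)
  have "monoid ?M"
    using comm_monoid_pres_monoid comm_monoid.axioms(1) unfolding sg_monoid_def by blast
  then have latL: "lattice ?L" by (rule order_ideal_lattice_lattice)
  have poL: "partial_order ?L"
    using latL by (simp add: lattice_def upper_semilattice_def)
  \<comment> \<open>Antisymmetry and transitivity are not evident from \<open>G\<^sub>1 \<subseteq> G\<^sub>2 \<union> C[H\<^sub>2]\<close>; they come from inclusion of ideals.\<close>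
  have poA: "partial_order ?A"
  proof unfold_locales
    fix p q assume pq: "p \<in> carrier ?A" "q \<in> carrier ?A" "le ?A p q" "le ?A q p"
    then have "\<phi> p = \<phi> q"
      using phi_le[of p q] phi_le[of q p] by (simp add: order_ideal_lattice_def)
    then have "p = q" using psi_phi pq by metis
    then show "eq ?A p q" by (simp add: admissible_pairs_def)
  next
    fix p q r assume "p \<in> carrier ?A" "q \<in> carrier ?A" "r \<in> carrier ?A" "le ?A p q" "le ?A q r"
    then show "le ?A p r"
      using phi_le[of p q] phi_le[of q r] phi_le[of p r] by (auto simp: order_ideal_lattice_def)
  qed (auto simp: admissible_pairs_def)
  note iso_psi = order_iso_lattice_iso[OF latL poA bij_psi psi_le]
  note iso_phi = order_iso_lattice_iso(2)[OF iso_psi(1) poL bij_phi phi_le]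
  have "(\<forall>(H, G) \<in> carrier ?A. \<phi> (H, G) = gen_order_ideal ?M (pair_submonoid E C S H G))"
    by (simp add: \<phi>_def)
  then show ?thesis
    using iso_psi(2) iso_phi phi_psi psi_phi
    by (intro exI[of _ \<phi>] exI[of _ \<psi>] conjI ballI) (auto simp: \<psi>_def)
qed


end
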